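(* Let $V$ be a valuation ring of finite Krull dimension. Suppose that the maximal ideal $\mathfrak m$ of $V$ is not principal. Then for all $V$-modules $M$, $R^i\Gamma_{\mathfrak m}(M) = 0$ for all $i \geq 3$.
   Context: Rings are commutative with identity. $\mathbb N$ denotes the positive integers. For a ring $A$ and an ideal $I \subset A$, the $I$-torsion functor $\Gamma_I$ on $A$-modules is $\Gamma_I(M) = \{m \in M : \exists\, n \in \mathbb N \text{ such that } I^n m = 0\}$. It is left exact, and its right derived functors are denoted $R^i\Gamma_I$, $i \ge 0$ (the $I$-torsion cohomology functors). *)

theory Defs
  imports "HOL-Library.Extended_Nat" "HOL-Algebra.Divisibility" "HOL-Algebra.Ideal_Product"
    "HOL-Algebra.QuotRing" "HOL-Algebra.Module"
begin

section \<open>Valuation rings and Krull dimension\<close>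

text \<open>For nonzero \<open>a\<close>, \<open>b\<close> in a domain \<open>V\<close>, the fraction \<open>b / a\<close> lies in \<open>V\<close> exactly if \<open>a\<close> divides \<open>b\<close>.
  So the axiom below says that \<open>x\<close> or its inverse lies in \<open>V\<close> for each nonzero \<open>x\<close> in the field of
  fractions. Fields are included.\<close>

locale valuation_ring = domain V for V (structure) +
  assumes divides_total:
    "\<lbrakk> a \<in> carrier V - {\<zero>}; b \<in> carrier V - {\<zero>} \<rbrakk> \<Longrightarrow> a divides b \<or> b divides a"

definition krull_dim :: "('a, 'r) ring_scheme \<Rightarrow> enat" where
  "krull_dim R = Sup {enat n | n. \<exists>P :: nat \<Rightarrow> 'a set.
     (\<forall>i\<le>n. primeideal (P i) R) \<and> (\<forall>i<n. P i \<subset> P (Suc i))}"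


section \<open>Linear maps, quotients, cohomology\<close>

definition module_hom ::
  "('a, 'r) ring_scheme \<Rightarrow> ('a, 'b, 'm) module_scheme \<Rightarrow> ('a, 'c, 'n) module_scheme \<Rightarrow> ('b \<Rightarrow> 'c) set"
  where
  "module_hom R M N = {h \<in> carrier M \<rightarrow> carrier N.
     (\<forall>x\<in>carrier M. \<forall>y\<in>carrier M. h (x \<oplus>\<^bsub>M\<^esub> y) = h x \<oplus>\<^bsub>N\<^esub> h y) \<and>
     (\<forall>a\<in>carrier R. \<forall>x\<in>carrier M. h (a \<odot>\<^bsub>M\<^esub> x) = a \<odot>\<^bsub>N\<^esub> h x)}"

text \<open>The multiplicative fields of a module record carry no meaning. As with \<^const>\<open>FactRing\<close>,
  the elements of the quotient are cosets.\<close>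

definition quotient_module :: "('a, 'b, 'm) module_scheme \<Rightarrow> 'b set \<Rightarrow> ('a, 'b set) module" where
  "quotient_module M N =
     \<lparr>carrier = a_rcosets\<^bsub>M\<^esub> N, mult = undefined, one = undefined, zero = N, add = set_add M,
      smult = (\<lambda>a K. \<Union>x\<in>K. N +>\<^bsub>M\<^esub> (a \<odot>\<^bsub>M\<^esub> x))\<rparr>"

definition zero_module :: "('a, 'b, 'm) module_scheme \<Rightarrow> bool" where
  "zero_module M \<longleftrightarrow> carrier M = {\<zero>\<^bsub>M\<^esub>}"

text \<open>A cochain complex is given by modules \<open>C 0, C 1, \<dots>\<close> and maps \<open>d i\<close> from \<open>C i\<close> to
  \<open>C (i + 1)\<close>; it is zero in negative degrees.\<close>

definition cocycles :: "(nat \<Rightarrow> ('a, 'b, 'm) module_scheme) \<Rightarrow> (nat \<Rightarrow> 'b \<Rightarrow> 'b) \<Rightarrow> nat \<Rightarrow> 'b set" where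
  "cocycles C d i = a_kernel (C i) (C (Suc i)) (d i)"

definition coboundaries :: "(nat \<Rightarrow> ('a, 'b, 'm) module_scheme) \<Rightarrow> (nat \<Rightarrow> 'b \<Rightarrow> 'b) \<Rightarrow> nat \<Rightarrow> 'b set" where
  "coboundaries C d i = (case i of 0 \<Rightarrow> {\<zero>\<^bsub>C 0\<^esub>} | Suc j \<Rightarrow> d j ` carrier (C j))"

definition cohomology ::
  "(nat \<Rightarrow> ('a, 'b, 'm) module_scheme) \<Rightarrow> (nat \<Rightarrow> 'b \<Rightarrow> 'b) \<Rightarrow> nat \<Rightarrow> ('a, 'b set) module" where
  "cohomology C d i = quotient_module (C i\<lparr>carrier := cocycles C d i\<rparr>) (coboundaries C d i)"


section \<open>Injective modules and resolutions\<close>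

text \<open>A definition cannot quantify over types, so the test modules \<open>A\<close>, \<open>B\<close> below have the type of
  the ring as carrier type. These include the ideals of \<open>R\<close> and \<open>R\<close> itself; by Baer's criterion,
  proved below as \<open>injective_module_extend\<close>, the extension property for test modules over
  every other carrier type follows.\<close>

definition injective_module :: "('a, 'r) ring_scheme \<Rightarrow> ('a, 'e, 'm) module_scheme \<Rightarrow> bool" where
  "injective_module R E \<longleftrightarrow> module R E \<and>
     (\<forall>(A :: ('a, 'a) module) (B :: ('a, 'a) module) f g.
        module R A \<and> module R B \<and> f \<in> module_hom R A B \<and> inj_on f (carrier A) \<and> g \<in> module_hom R A E
        \<longrightarrow> (\<exists>h\<in>module_hom R B E. \<forall>x\<in>carrier A. h (f x) = g x))"

definition ideal_module :: "('a, 'r) ring_scheme \<Rightarrow> 'a set \<Rightarrow> ('a, 'a) module" where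
  "ideal_module R J =
     \<lparr>carrier = J, mult = mult R, one = one R, zero = zero R, add = add R, smult = mult R\<rparr>"

lemma ideal_module_is_module:
  assumes "cring R" "ideal J R"
  shows "module R (ideal_module R J)"
proof -
  interpret cring R by fact
  interpret J: ideal J R by fact
  show ?thesis
  proof (rule moduleI)
    show "abelian_group (ideal_module R J)"
    proof (rule abelian_groupI, simp_all add: ideal_module_def)
      fix x assume "x \<in> J"
      then show "\<exists>y\<in>J. y \<oplus>\<^bsub>R\<^esub> x = \<zero>\<^bsub>R\<^esub>"
        by (metis J.Icarr J.a_inv_closed l_neg)
    qed (auto simp: J.Icarr a_ac)
  qed (use \<open>cring R\<close> in \<open>auto simp: ideal_module_def J.I_l_closed J.Icarr l_distr r_distr m_assoc\<close>)
qed

lemma injective_module_extend: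
  fixes R :: "('a, 'r) ring_scheme" and E :: "('a, 'e, 'm) module_scheme"
    and A :: "('a, 'b, 'k) module_scheme" and B :: "('a, 'c, 'l) module_scheme"
  assumes inj: "injective_module R E" and A: "module R A" and B: "module R B"
    and f: "f \<in> module_hom R A B" "inj_on f (carrier A)" and g: "g \<in> module_hom R A E"
  shows "\<exists>h\<in>module_hom R B E. \<forall>x\<in>carrier A. h (f x) = g x"
proof -
  interpret E: module R E using inj by (simp add: injective_module_def)
  interpret A: module R A by fact
  interpret B: module R B by fact
  have fc: "f x \<in> carrier B" if "x \<in> carrier A" for x using f that by (auto simp: module_hom_def)
  have gc: "g x \<in> carrier E" if "x \<in> carrier A" for x using g that by (auto simp: module_hom_def)
  have fa: "f (x \<oplus>\<^bsub>A\<^esub> y) = f x \<oplus>\<^bsub>B\<^esub> f y" "g (x \<oplus>\<^bsub>A\<^esub> y) = g x \<oplus>\<^bsub>E\<^esub> g y"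
    if "x \<in> carrier A" "y \<in> carrier A" for x y using f g that by (auto simp: module_hom_def)
  have fs: "f (a \<odot>\<^bsub>A\<^esub> x) = a \<odot>\<^bsub>B\<^esub> f x" "g (a \<odot>\<^bsub>A\<^esub> x) = a \<odot>\<^bsub>E\<^esub> g x"
    if "a \<in> carrier R" "x \<in> carrier A" for a x using f g that by (auto simp: module_hom_def)
  define lin where "lin G \<longleftrightarrow> G \<subseteq> carrier B \<times> carrier E \<and>
      (\<forall>x u y v. (x, u) \<in> G \<and> (y, v) \<in> G \<longrightarrow> (x \<oplus>\<^bsub>B\<^esub> y, u \<oplus>\<^bsub>E\<^esub> v) \<in> G) \<and>
      (\<forall>a x u. a \<in> carrier R \<and> (x, u) \<in> G \<longrightarrow> (a \<odot>\<^bsub>B\<^esub> x, a \<odot>\<^bsub>E\<^esub> u) \<in> G) \<and>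
      (\<forall>u. (\<zero>\<^bsub>B\<^esub>, u) \<in> G \<longrightarrow> u = \<zero>\<^bsub>E\<^esub>)" for G
  define G0 where "G0 = (\<lambda>x. (f x, g x)) ` carrier A"
  define S where "S = {G. lin G \<and> G0 \<subseteq> G}"
  have f0: "f \<zero>\<^bsub>A\<^esub> = \<zero>\<^bsub>B\<^esub>" "g \<zero>\<^bsub>A\<^esub> = \<zero>\<^bsub>E\<^esub>"
    using fs[of "\<zero>\<^bsub>R\<^esub>" "\<zero>\<^bsub>A\<^esub>"] fc[of "\<zero>\<^bsub>A\<^esub>"] gc[of "\<zero>\<^bsub>A\<^esub>"] by simp_all
  have "lin G0"
    unfolding lin_def
  proof (intro conjI allI impI)
    show "G0 \<subseteq> carrier B \<times> carrier E" using fc gc by (auto simp: G0_def)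
    show "(x \<oplus>\<^bsub>B\<^esub> y, u \<oplus>\<^bsub>E\<^esub> v) \<in> G0" if "(x, u) \<in> G0 \<and> (y, v) \<in> G0" for x u y v
    proof -
      from that obtain p q where "p \<in> carrier A" "q \<in> carrier A" "x = f p" "u = g p" "y = f q" "v = g q"
        by (auto simp: G0_def)
      then show ?thesis unfolding G0_def by (intro image_eqI[of _ _ "p \<oplus>\<^bsub>A\<^esub> q"]) (auto simp: fa)
    qed
    show "(a \<odot>\<^bsub>B\<^esub> x, a \<odot>\<^bsub>E\<^esub> u) \<in> G0" if "a \<in> carrier R \<and> (x, u) \<in> G0" for a x u
    proof -
      from that obtain p where "p \<in> carrier A" "x = f p" "u = g p" by (auto simp: G0_def)
      then show ?thesis unfolding G0_def using that
        by (intro image_eqI[of _ _ "a \<odot>\<^bsub>A\<^esub> p"]) (auto simp: fs)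
    qed
    show "u = \<zero>\<^bsub>E\<^esub>" if "(\<zero>\<^bsub>B\<^esub>, u) \<in> G0" for u
    proof -
      from that obtain p where p: "p \<in> carrier A" "\<zero>\<^bsub>B\<^esub> = f p" "u = g p" by (auto simp: G0_def)
      then have "p = \<zero>\<^bsub>A\<^esub>" using f(2) f0 by (metis A.M.zero_closed inj_onD)
      then show ?thesis using p f0 by simp
    qed
  qed
  then have ne: "S \<noteq> {}" by (auto simp: S_def)
  have chain: "\<Union>C \<in> S" if C: "C \<noteq> {}" "subset.chain S C" for C
  proof -
    have CS: "lin G" "G0 \<subseteq> G" if "G \<in> C" for G
      using C(2) that by (auto simp: S_def subset_chain_def)
    have cmp: "G \<subseteq> H \<or> H \<subseteq> G" if "G \<in> C" "H \<in> C" for G H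
      using C(2) that by (auto simp: subset_chain_def)
    have "lin (\<Union>C)"
      unfolding lin_def
    proof (intro conjI allI impI)
      show "\<Union>C \<subseteq> carrier B \<times> carrier E" using CS(1) unfolding lin_def by blast
      show "(x \<oplus>\<^bsub>B\<^esub> y, u \<oplus>\<^bsub>E\<^esub> v) \<in> \<Union>C" if xy: "(x, u) \<in> \<Union>C \<and> (y, v) \<in> \<Union>C" for x u y v
      proof -
        from xy obtain G H where GH: "G \<in> C" "(x, u) \<in> G" "H \<in> C" "(y, v) \<in> H" by blast
        then obtain K where "K \<in> C" "(x, u) \<in> K" "(y, v) \<in> K" using cmp[of G H] by blast
        then show ?thesis using CS(1)[of K] unfolding lin_def by blast
      qed
      show "(a \<odot>\<^bsub>B\<^esub> x, a \<odot>\<^bsub>E\<^esub> u) \<in> \<Union>C" if "a \<in> carrier R \<and> (x, u) \<in> \<Union>C" for a x u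
        using that CS(1) unfolding lin_def by blast
      show "u = \<zero>\<^bsub>E\<^esub>" if "(\<zero>\<^bsub>B\<^esub>, u) \<in> \<Union>C" for u
        using that CS(1) unfolding lin_def by blast
    qed
    then show ?thesis using C(1) CS(2) by (auto simp: S_def)
  qed
  obtain G where GS: "G \<in> S" and Gmax: "\<And>H. H \<in> S \<Longrightarrow> G \<subseteq> H \<Longrightarrow> H = G"
    using subset_Zorn_nonempty[OF ne chain] by blast
  have G0: "G0 \<subseteq> G" and Gsub: "\<And>x u. (x, u) \<in> G \<Longrightarrow> x \<in> carrier B \<and> u \<in> carrier E"
    and Gadd: "\<And>x u y v. (x, u) \<in> G \<Longrightarrow> (y, v) \<in> G \<Longrightarrow> (x \<oplus>\<^bsub>B\<^esub> y, u \<oplus>\<^bsub>E\<^esub> v) \<in> G"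
    and Gsm: "\<And>a x u. a \<in> carrier R \<Longrightarrow> (x, u) \<in> G \<Longrightarrow> (a \<odot>\<^bsub>B\<^esub> x, a \<odot>\<^bsub>E\<^esub> u) \<in> G"
    and Gz: "\<And>u. (\<zero>\<^bsub>B\<^esub>, u) \<in> G \<Longrightarrow> u = \<zero>\<^bsub>E\<^esub>"
    using GS unfolding S_def lin_def by blast+
  have Gneg: "(\<ominus>\<^bsub>B\<^esub> x, \<ominus>\<^bsub>E\<^esub> u) \<in> G" if "(x, u) \<in> G" for x u
    using Gsm[OF _ that, of "\<ominus>\<^bsub>R\<^esub> \<one>\<^bsub>R\<^esub>"] Gsub[OF that]
    by (simp add: B.smult_l_minus E.smult_l_minus)
  have Guniq: "u = v" if "(x, u) \<in> G" "(x, v) \<in> G" for x u v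
  proof -
    have "(\<zero>\<^bsub>B\<^esub>, u \<oplus>\<^bsub>E\<^esub> \<ominus>\<^bsub>E\<^esub> v) \<in> G"
      using Gadd[OF that(1) Gneg[OF that(2)]] Gsub[OF that(1)] by (simp add: B.M.r_neg)
    then have "u \<oplus>\<^bsub>E\<^esub> \<ominus>\<^bsub>E\<^esub> v = \<zero>\<^bsub>E\<^esub>" by (rule Gz)
    then show ?thesis using Gsub that by (metis E.M.minus_equality E.M.minus_minus E.M.add.inv_closed E.M.a_comm)
  qed
  have G00: "(\<zero>\<^bsub>B\<^esub>, \<zero>\<^bsub>E\<^esub>) \<in> G" using G0 f0 A.M.zero_closed by (force simp: G0_def)
  have total: "\<exists>u. (y, u) \<in> G" if y: "y \<in> carrier B" for y
  proof -
    define J where "J = {a \<in> carrier R. \<exists>u. (a \<odot>\<^bsub>B\<^esub> y, u) \<in> G}"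
    define \<phi> where "\<phi> a = (THE u. (a \<odot>\<^bsub>B\<^esub> y, u) \<in> G)" for a
    have \<phi>: "(a \<odot>\<^bsub>B\<^esub> y, u) \<in> G \<Longrightarrow> \<phi> a = u" for a u
      unfolding \<phi>_def using Guniq by blast
    have \<phi>G: "(a \<odot>\<^bsub>B\<^esub> y, \<phi> a) \<in> G" if "a \<in> J" for a
      using that \<phi> by (auto simp: J_def)
    have JR: "a \<in> carrier R" if "a \<in> J" for a using that by (simp add: J_def)
    have Jadd: "((a \<oplus>\<^bsub>R\<^esub> b) \<odot>\<^bsub>B\<^esub> y, \<phi> a \<oplus>\<^bsub>E\<^esub> \<phi> b) \<in> G" if "a \<in> J" "b \<in> J" for a b
      using Gadd[OF \<phi>G[OF that(1)] \<phi>G[OF that(2)]] that y by (simp add: JR B.smult_l_distr)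
    have Jsm: "((r \<otimes>\<^bsub>R\<^esub> a) \<odot>\<^bsub>B\<^esub> y, r \<odot>\<^bsub>E\<^esub> \<phi> a) \<in> G" if "a \<in> J" "r \<in> carrier R" for a r
      using Gsm[OF that(2) \<phi>G[OF that(1)]] that y by (simp add: JR B.smult_assoc1)
    have J: "ideal J R"
    proof (rule idealI)
      show "ring R" by (rule E.R.ring_axioms)
      show "subgroup J (add_monoid R)"
      proof (rule E.R.add.subgroupI)
        show "J \<subseteq> carrier R" using JR by blast
        have "\<zero>\<^bsub>R\<^esub> \<in> J" using G00 y by (auto simp: J_def)
        then show "J \<noteq> {}" by blast
        show "\<ominus>\<^bsub>R\<^esub> a \<in> J" if "a \<in> J" for a
          using Gneg[OF \<phi>G[OF that]] that y by (auto simp: J_def B.smult_l_minus)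
        show "a \<oplus>\<^bsub>R\<^esub> b \<in> J" if "a \<in> J" "b \<in> J" for a b
          using Jadd[OF that] that by (auto simp: J_def)
      qed
      show "r \<otimes>\<^bsub>R\<^esub> a \<in> J" if "a \<in> J" "r \<in> carrier R" for a r
        using Jsm[OF that] that by (auto simp: J_def)
      then show "a \<otimes>\<^bsub>R\<^esub> r \<in> J" if "a \<in> J" "r \<in> carrier R" for a r
        using that by (metis E.R.m_comm JR)
    qed
    have mods: "module R (ideal_module R J)" "module R (ideal_module R (carrier R))"
      using ideal_module_is_module[OF E.R.is_cring] J E.R.oneideal by blast+
    have "id \<in> module_hom R (ideal_module R J) (ideal_module R (carrier R))"
      using JR by (auto simp: module_hom_def ideal_module_def)
    moreover have "\<phi> \<in> module_hom R (ideal_module R J) E"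
      using \<phi>[OF Jadd] \<phi>[OF Jsm] Gsub[OF \<phi>G] by (auto simp: module_hom_def ideal_module_def)
    ultimately obtain h where h: "h \<in> module_hom R (ideal_module R (carrier R)) E"
      and h\<phi>: "\<And>a. a \<in> J \<Longrightarrow> h a = \<phi> a"
      using inj mods unfolding injective_module_def
      by (fastforce simp: ideal_module_def)
    define e where "e = h \<one>\<^bsub>R\<^esub>"
    have e: "e \<in> carrier E" using h by (auto simp: e_def module_hom_def ideal_module_def)
    have he: "h a = a \<odot>\<^bsub>E\<^esub> e" if "a \<in> carrier R" for a
    proof -
      have "h (a \<otimes>\<^bsub>R\<^esub> \<one>\<^bsub>R\<^esub>) = a \<odot>\<^bsub>E\<^esub> h \<one>\<^bsub>R\<^esub>"
        using h that by (auto simp: module_hom_def ideal_module_def simp del: E.R.r_one)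
      then show ?thesis using that by (simp add: e_def)
    qed
    define H where "H = {(x \<oplus>\<^bsub>B\<^esub> a \<odot>\<^bsub>B\<^esub> y, u \<oplus>\<^bsub>E\<^esub> a \<odot>\<^bsub>E\<^esub> e) | x u a. (x, u) \<in> G \<and> a \<in> carrier R}"
    have GH: "G \<subseteq> H"
    proof
      fix p assume "p \<in> G"
      then show "p \<in> H" unfolding H_def using Gsub y e
        by (cases p) (force intro!: exI[of _ "\<zero>\<^bsub>R\<^esub>"])
    qed
    have "lin H"
      unfolding lin_def
    proof (intro conjI allI impI)
      show "H \<subseteq> carrier B \<times> carrier E" using Gsub y e by (auto simp: H_def)
      show "(x \<oplus>\<^bsub>B\<^esub> x', u \<oplus>\<^bsub>E\<^esub> u') \<in> H" if "(x, u) \<in> H \<and> (x', u') \<in> H" for x u x' u'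
      proof -
        from that obtain p s a p' s' a' where 1: "(p, s) \<in> G" "(p', s') \<in> G" "a \<in> carrier R" "a' \<in> carrier R"
          and 2: "x = p \<oplus>\<^bsub>B\<^esub> a \<odot>\<^bsub>B\<^esub> y" "u = s \<oplus>\<^bsub>E\<^esub> a \<odot>\<^bsub>E\<^esub> e"
            "x' = p' \<oplus>\<^bsub>B\<^esub> a' \<odot>\<^bsub>B\<^esub> y" "u' = s' \<oplus>\<^bsub>E\<^esub> a' \<odot>\<^bsub>E\<^esub> e"
          unfolding H_def by blast
        have "x \<oplus>\<^bsub>B\<^esub> x' = (p \<oplus>\<^bsub>B\<^esub> p') \<oplus>\<^bsub>B\<^esub> (a \<oplus>\<^bsub>R\<^esub> a') \<odot>\<^bsub>B\<^esub> y"
          using 1 2 y Gsub by (simp add: B.smult_l_distr B.M.a_ac)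
        moreover have "u \<oplus>\<^bsub>E\<^esub> u' = (s \<oplus>\<^bsub>E\<^esub> s') \<oplus>\<^bsub>E\<^esub> (a \<oplus>\<^bsub>R\<^esub> a') \<odot>\<^bsub>E\<^esub> e"
          using 1 2 e Gsub by (simp add: E.smult_l_distr E.M.a_ac)
        ultimately show ?thesis unfolding H_def using Gadd[OF 1(1,2)] 1(3,4) by blast
      qed
      show "(b \<odot>\<^bsub>B\<^esub> x, b \<odot>\<^bsub>E\<^esub> u) \<in> H" if "b \<in> carrier R \<and> (x, u) \<in> H" for b x u
      proof -
        from that obtain p s a where 1: "(p, s) \<in> G" "a \<in> carrier R" "b \<in> carrier R"
          and 2: "x = p \<oplus>\<^bsub>B\<^esub> a \<odot>\<^bsub>B\<^esub> y" "u = s \<oplus>\<^bsub>E\<^esub> a \<odot>\<^bsub>E\<^esub> e"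
          unfolding H_def by blast
        have "b \<odot>\<^bsub>B\<^esub> x = b \<odot>\<^bsub>B\<^esub> p \<oplus>\<^bsub>B\<^esub> (b \<otimes>\<^bsub>R\<^esub> a) \<odot>\<^bsub>B\<^esub> y"
          using 1 2 y Gsub by (simp add: B.smult_r_distr B.smult_assoc1)
        moreover have "b \<odot>\<^bsub>E\<^esub> u = b \<odot>\<^bsub>E\<^esub> s \<oplus>\<^bsub>E\<^esub> (b \<otimes>\<^bsub>R\<^esub> a) \<odot>\<^bsub>E\<^esub> e"
          using 1 2 e Gsub by (simp add: E.smult_r_distr E.smult_assoc1)
        ultimately show ?thesis unfolding H_def using Gsm[OF 1(3,1)] E.R.m_closed[OF 1(3,2)] by blast
      qed
      show "u = \<zero>\<^bsub>E\<^esub>" if "(\<zero>\<^bsub>B\<^esub>, u) \<in> H" for u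
      proof -
        from that obtain p s a where 1: "(p, s) \<in> G" "a \<in> carrier R"
          and 2: "\<zero>\<^bsub>B\<^esub> = p \<oplus>\<^bsub>B\<^esub> a \<odot>\<^bsub>B\<^esub> y" "u = s \<oplus>\<^bsub>E\<^esub> a \<odot>\<^bsub>E\<^esub> e"
          unfolding H_def by blast
        have pc: "p \<in> carrier B" "s \<in> carrier E" "a \<odot>\<^bsub>B\<^esub> y \<in> carrier B" using 1 Gsub y by auto
        have "a \<odot>\<^bsub>B\<^esub> y = \<ominus>\<^bsub>B\<^esub> p"
          using 2(1) pc by (metis B.M.a_comm B.M.minus_equality)
        then have ay: "(a \<odot>\<^bsub>B\<^esub> y, \<ominus>\<^bsub>E\<^esub> s) \<in> G" using Gneg[OF 1(1)] by simp
        then have "a \<in> J" using 1(2) by (auto simp: J_def)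
        then have "a \<odot>\<^bsub>E\<^esub> e = \<ominus>\<^bsub>E\<^esub> s" using he[OF 1(2)] h\<phi> \<phi>[OF ay] by simp
        then show ?thesis using 2(2) pc by (simp add: E.M.r_neg)
      qed
    qed
    then have "H \<in> S" using G0 GH by (auto simp: S_def)
    then have "H = G" using Gmax GH by blast
    moreover have "(y, e) \<in> H"
      unfolding H_def using G00 y e
      by (force intro!: exI[of _ "\<zero>\<^bsub>B\<^esub>"] exI[of _ "\<zero>\<^bsub>E\<^esub>"] exI[of _ "\<one>\<^bsub>R\<^esub>"])
    ultimately show ?thesis by blast
  qed
  define h where "h y = (THE u. (y, u) \<in> G)" for y
  have h: "h y = u" if "(y, u) \<in> G" for y u
    unfolding h_def using that Guniq by blast
  have hG: "(y, h y) \<in> G" if "y \<in> carrier B" for y using total[OF that] h by auto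
  have "h \<in> module_hom R B E"
    using h[OF Gadd[OF hG hG]] h[OF Gsm[OF _ hG]] Gsub[OF hG] by (auto simp: module_hom_def)
  moreover have "\<forall>x\<in>carrier A. h (f x) = g x"
    using G0 h by (auto simp: G0_def)
  ultimately show ?thesis by blast
qed

text \<open>Exactness of \<open>0 \<rightarrow> M \<rightarrow> E 0 \<rightarrow> E 1 \<rightarrow> \<dots>\<close> with all \<open>E n\<close> injective. One carrier type for all \<open>E n\<close>
  is no restriction, as countably many modules can be copied into a common type.\<close>

definition injective_resolution ::
  "('a, 'r) ring_scheme \<Rightarrow> ('a, 'b, 'm) module_scheme \<Rightarrow> (nat \<Rightarrow> ('a, 'e, 'n) module_scheme) \<Rightarrow>
   (nat \<Rightarrow> 'e \<Rightarrow> 'e) \<Rightarrow> ('b \<Rightarrow> 'e) \<Rightarrow> bool" where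
  "injective_resolution R M E d \<epsilon> \<longleftrightarrow>
     (\<forall>n. injective_module R (E n)) \<and>
     (\<forall>n. d n \<in> module_hom R (E n) (E (Suc n))) \<and>
     \<epsilon> \<in> module_hom R M (E 0) \<and>
     inj_on \<epsilon> (carrier M) \<and>
     \<epsilon> ` carrier M = a_kernel (E 0) (E 1) (d 0) \<and>
     (\<forall>n. d n ` carrier (E n) = a_kernel (E (Suc n)) (E (Suc (Suc n))) (d (Suc n)))"


section \<open>Torsion and its right derived functors\<close>

definition torsion_module ::
  "('a, 'r) ring_scheme \<Rightarrow> 'a set \<Rightarrow> ('a, 'b, 'm) module_scheme \<Rightarrow> ('a, 'b, 'm) module_scheme" where
  "torsion_module R I M =
     M\<lparr>carrier := {x \<in> carrier M. \<exists>n::nat. n \<ge> 1 \<and>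
                     (\<forall>a \<in> I [^]\<^bsub>ideals_set R\<^esub> n. a \<odot>\<^bsub>M\<^esub> x = \<zero>\<^bsub>M\<^esub>)}\<rparr>"

text \<open>If \<open>(E, d)\<close> is an injective resolution of \<open>M\<close>, this is the \<open>i\<close>-th right derived functor of
  \<open>I\<close>-torsion at \<open>M\<close>. On morphisms the torsion functor is restriction, so it leaves the
  differentials unchanged.\<close>

definition torsion_cohomology ::
  "('a, 'r) ring_scheme \<Rightarrow> 'a set \<Rightarrow> (nat \<Rightarrow> ('a, 'e, 'n) module_scheme) \<Rightarrow> (nat \<Rightarrow> 'e \<Rightarrow> 'e) \<Rightarrow> nat \<Rightarrow>
   ('a, 'e set) module" where
  "torsion_cohomology R I E d i = cohomology (\<lambda>n. torsion_module R I (E n)) d i"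

end

theory Submission
  imports Defs
begin

text \<open>As \<open>\<mm>\<close> is not principal, \<open>\<mm>\<^sup>2 = \<mm>\<close>, so the \<open>\<mm>\<close>-torsion of a module consists of the elements that
  \<open>\<mm>\<close> annihilates. Since the dimension is finite, \<open>\<mm>\<close> is the radical of a principal ideal \<open>(t)\<close>, and a
  sequence \<open>u 0 = t\<close>, \<open>u (n + 1)\<^sup>2 | u n\<close> in \<open>\<mm>\<close> generates \<open>\<mm>\<close>. So \<open>\<mm>\<close> is a countable increasing
  union of free modules of rank one and has projective dimension at most one, which gives
  \<open>Ext\<^sup>i(V/\<mm>, M) = 0\<close> for \<open>i \<ge> 3\<close>. Concretely, let \<open>x = d y\<close> be a cocycle of degree \<open>i\<close> annihilated by \<open>\<mm>\<close>.
  Each \<open>u n \<cdot> y\<close> is some \<open>d z\<^sub>n\<close>; as injective modules are divisible, the \<open>z\<^sub>n\<close> can be corrected by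
  boundaries from degree \<open>i - 3\<close> such that \<open>u n \<mapsto> z\<^sub>n\<close> defines a linear map on \<open>\<mm>\<close>. It extends to \<open>V\<close>
  and is thus multiplication by some \<open>z\<close>, and \<open>\<mm>\<close> annihilates \<open>y - d z\<close>.\<close>

section \<open>Maximal ideals of valuation rings\<close>

context valuation_ring
begin

section \<open>Divisibility and powers in a valuation ring\<close>

lemma divides_linear:
  assumes "a \<in> carrier V" "b \<in> carrier V"
  shows "a divides b \<or> b divides a"
proof (cases "a = \<zero> \<or> b = \<zero>")
  case True
  then show ?thesis using assms by (auto intro!: dividesI[of \<zero>])
next
  case False
  then show ?thesis using divides_total assms by blast
qed

lemma nat_pow_nonzero:
  assumes "a \<in> carrier V" "a \<noteq> \<zero>"
  shows "a [^] (n::nat) \<noteq> \<zero>"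
  using assms by (induct n) (auto simp: integral_iff)

lemma divides_nat_pow:
  assumes "a divides b" "a \<in> carrier V" "b \<in> carrier V"
  shows "a [^] (n::nat) divides b [^] n"
  using assms by (auto simp: factor_def nat_pow_distrib)

lemma nat_pow_divides_nat_pow:
  assumes "a \<in> carrier V" "n \<le> k"
  shows "a [^] (n::nat) divides a [^] (k::nat)"
  using assms by (intro dividesI[of "a [^] (k - n)"]) (simp_all add: nat_pow_mult)

text \<open>Otherwise total divisibility gives \<open>a = b \<otimes> c\<close>. Cancelling
  \<open>b [^] n\<close> in the hypothesis makes \<open>c\<close> a unit, so \<open>a\<close>
  divides \<open>b\<close> after all.\<close>

lemma nat_pow_divides_cancel:
  fixes n :: nat
  assumes a: "a \<in> carrier V" and b: "b \<in> carrier V" and "a [^] n divides b [^] n" "n > 0"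
  shows "a divides b"
proof (cases "a divides b")
  case False
  then obtain c where c: "c \<in> carrier V" "a = b \<otimes> c"
    using divides_linear[OF a b] by (auto simp: factor_def)
  have "b \<noteq> \<zero>" using False a by (auto intro!: dividesI[of \<zero>])
  then have bn: "b [^] n \<noteq> \<zero>" using b nat_pow_nonzero by blast
  obtain e where e: "e \<in> carrier V" "b [^] n = a [^] n \<otimes> e"
    using assms(3) by (auto simp: factor_def)
  have "b [^] n \<otimes> (c [^] n \<otimes> e) = a [^] n \<otimes> e"
    unfolding c(2) using b c(1) e(1) by (simp add: nat_pow_distrib m_assoc)
  also have "\<dots> = b [^] n \<otimes> \<one>" unfolding e(2)[symmetric] using b by simp
  finally have "c [^] n \<otimes> e = \<one>"
    using bn b c(1) e(1) by (metis m_lcancel nat_pow_closed m_closed one_closed)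
  moreover obtain k where "n = Suc k" using \<open>n > 0\<close> by (cases n) auto
  ultimately have "c \<otimes> (c [^] k \<otimes> e) = \<one>" using c(1) e(1) by (simp add: m_assoc m_comm m_lcomm)
  then have "b = a \<otimes> (c [^] k \<otimes> e)" unfolding c(2) using b c(1) e(1) by (simp add: m_assoc)
  then show ?thesis using c(1) e(1) by (intro dividesI[of "c [^] k \<otimes> e"]) simp_all
qed

section \<open>Radicals of principal ideals and the Krull dimension\<close>

definition radical :: "'a \<Rightarrow> 'a set" where
  "radical t = {x \<in> carrier V. \<exists>n::nat. t divides x [^] n}"

lemma radical_multiple:
  assumes "t \<in> carrier V" "x \<in> radical t" "x divides z" "z \<in> carrier V"
  shows "z \<in> radical t"
proof -
  obtain n :: nat where "x \<in> carrier V" "t divides x [^] n" using assms(2) by (auto simp: radical_def)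
  then have "t divides z [^] n"
    using divides_trans[OF _ divides_nat_pow[OF assms(3)]] assms(1,4) by blast
  then show ?thesis using assms(4) unfolding radical_def by blast
qed

text \<open>Everything rests on total divisibility. Of two elements one is a multiple of the other,
  so their sum is a multiple of one of them. Likewise \<open>a \<otimes> b\<close> divides the
  square of \<open>a\<close> or of \<open>b\<close>, and a radical contains every element whose
  square it contains.\<close>

lemma radical_primeideal:
  assumes t: "t \<in> carrier V" "\<not> t divides \<one>"
  shows "primeideal (radical t) V"
proof (rule primeidealI)
  have rc: "x \<in> carrier V" if "x \<in> radical t" for x using that by (simp add: radical_def)
  have mult: "x \<otimes> r \<in> radical t" if "x \<in> radical t" "r \<in> carrier V" for x r
    using radical_multiple[OF t(1) that(1), of "x \<otimes> r"] that rc by (auto intro: dividesI)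
  show "ideal (radical t) V"
  proof (rule idealI)
    show "subgroup (radical t) (add_monoid V)"
    proof (rule add.subgroupI)
      show "radical t \<subseteq> carrier V" using rc by blast
      have "t \<in> radical t" using t by (auto simp: radical_def intro!: exI[of _ "1::nat"])
      then show "radical t \<noteq> {}" by blast
      show "\<ominus> a \<in> radical t" if "a \<in> radical t" for a
        using mult[OF that, of "\<ominus> \<one>"] rc[OF that] by (simp add: r_minus)
      show "a \<oplus> b \<in> radical t" if ab: "a \<in> radical t" "b \<in> radical t" for a b
      proof -
        consider c where "c \<in> carrier V" "b = a \<otimes> c" | c where "c \<in> carrier V" "a = b \<otimes> c"
          using divides_linear[OF rc[OF ab(1)] rc[OF ab(2)]] by (auto simp: factor_def)
        then show ?thesis
        proof cases
          case 1
          then show ?thesis using mult[OF ab(1), of "\<one> \<oplus> c"] rc[OF ab(1)] by (simp add: r_distr)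
        next
          case 2
          then show ?thesis using mult[OF ab(2), of "c \<oplus> \<one>"] rc[OF ab(2)] by (simp add: r_distr)
        qed
      qed
    qed
    show "x \<otimes> r \<in> radical t" if "x \<in> radical t" "r \<in> carrier V" for x r by (rule mult[OF that])
    then show "r \<otimes> x \<in> radical t" if "x \<in> radical t" "r \<in> carrier V" for x r
      using that rc m_comm by metis
  qed (rule ring_axioms)
  show "cring V" by (rule is_cring)
  have "\<one> \<notin> radical t" using t by (simp add: radical_def)
  then show "carrier V \<noteq> radical t" by blast
  have sq: "y \<in> radical t" if "y \<otimes> y \<in> radical t" "y \<in> carrier V" for y
  proof -
    from that obtain n :: nat where "t divides (y \<otimes> y) [^] n" by (auto simp: radical_def)
    moreover have "(y \<otimes> y) [^] n = y [^] (n + n)" using that(2) by (simp add: nat_pow_distrib nat_pow_mult)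
    ultimately show ?thesis using that(2) unfolding radical_def by auto
  qed
  show "a \<in> radical t \<or> b \<in> radical t" if ab: "a \<in> carrier V" "b \<in> carrier V" "a \<otimes> b \<in> radical t" for a b
  proof -
    have "a \<otimes> b divides b \<otimes> b \<or> a \<otimes> b divides a \<otimes> a"
      using divides_linear[OF ab(1,2)] ab divides_mult_rI divides_mult_lI by metis
    then show ?thesis using radical_multiple[OF t(1) ab(3)] sq ab by blast
  qed
qed

lemma krull_dim_infinite:
  assumes "\<And>i. primeideal (P i) V" "\<And>i::nat. P i \<subset> P (Suc i)"
  shows "krull_dim V = \<infinity>"
proof -
  have "enat n \<le> krull_dim V" for n
    unfolding krull_dim_def by (rule Sup_upper) (use assms in blast)
  then show ?thesis by (metis enat_ile enat_ord_simps(1) not_infinity_eq not_less_eq_eq order_refl)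
qed

text \<open>Otherwise \<open>radical t\<close> could be enlarged again and again, and all these ideals are prime.\<close>

lemma maximalideal_subset_radical:
  assumes fin: "krull_dim V < \<infinity>" and m: "maximalideal \<mm> V"
  shows "\<exists>t\<in>\<mm>. \<mm> \<subseteq> radical t"
proof (rule ccontr)
  interpret m: maximalideal \<mm> V by fact
  assume "\<not> (\<exists>t\<in>\<mm>. \<mm> \<subseteq> radical t)"
  then have "\<forall>t\<in>\<mm>. \<exists>b. b \<in> \<mm> \<and> b \<notin> radical t" by blast
  then obtain f where f: "\<And>t. t \<in> \<mm> \<Longrightarrow> f t \<in> \<mm> \<and> f t \<notin> radical t" by metis
  \<comment> \<open>Each application of \<open>f\<close> leaves the current radical. The iteration
    may start anywhere in \<open>\<mm>\<close>.\<close>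
  define t where "t i = (f ^^ i) \<zero>" for i
  have tm: "t i \<in> \<mm>" for i by (induct i) (auto simp: t_def f)
  have nu: "\<not> b divides \<one>" if "b \<in> \<mm>" for b
    using that m.I_r_closed m.one_imp_carrier m.I_notcarr by (auto simp: factor_def)
  have "radical (t i) \<subset> radical (t (Suc i))" for i
  proof -
    let ?t = "t i" and ?b = "t (Suc i)"
    have b: "?b \<in> carrier V" "?b \<notin> radical ?t" and tc: "?t \<in> carrier V"
      using f[OF tm[of i]] tm m.Icarr by (auto simp: t_def)
    \<comment> \<open>If \<open>?t\<close> divided \<open>?b\<close>, exponent 1 would put
      \<open>?b\<close> into \<open>radical ?t\<close>. Hence \<open>?b\<close> divides
      \<open>?t\<close>, and the radicals are nested.\<close>
    have "\<not> ?t divides ?b" using b by (auto simp: radical_def dest: spec[of _ "1::nat"])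
    then have "?b divides ?t" using divides_linear b(1) tc by blast
    then have "radical ?t \<subseteq> radical ?b" using b divides_trans unfolding radical_def by blast
    moreover have "?b \<in> radical ?b" using b(1) by (auto simp: radical_def intro!: exI[of _ "1::nat"])
    ultimately show ?thesis using b(2) by blast
  qed
  moreover have "primeideal (radical (t i)) V" for i
    using radical_primeideal nu tm m.Icarr by blast
  ultimately show False using krull_dim_infinite[of "\<lambda>i. radical (t i)"] fin by auto
qed

section \<open>Idempotence and a chain of generators of a non-principal maximal ideal\<close>

text \<open>This is \<open>\<mm>\<close> = \<open>\<mm>\<close> squared, elementwise. Since
  \<open>PIdl a\<close> is not all of \<open>\<mm>\<close>, some \<open>b\<close> in
  \<open>\<mm>\<close> lies outside it and divides \<open>a\<close>. The cofactor is in
  \<open>\<mm>\<close>, for a unit cofactor would put \<open>b\<close> into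
  \<open>PIdl a\<close>.\<close>

lemma nonprincipal_maximalideal_prod:
  assumes m: "maximalideal \<mm> V" and np: "\<not> principalideal \<mm> V" and a: "a \<in> \<mm>"
  obtains b c where "b \<in> \<mm>" "c \<in> \<mm>" "a = b \<otimes> c"
proof -
  interpret m: maximalideal \<mm> V by fact
  have PIdl_ne: "PIdl x \<noteq> \<mm>" if "x \<in> carrier V" for x
    using cgenideal_is_principalideal[OF that] np by auto
  have ac: "a \<in> carrier V" using a m.Icarr by blast
  have "PIdl a \<subseteq> \<mm>" using a m.I_l_closed by (auto simp: cgenideal_def)
  then obtain b where b: "b \<in> \<mm>" "b \<notin> PIdl a" using PIdl_ne[OF ac] by blast
  then have bc: "b \<in> carrier V" using m.Icarr by blast
  have nd: "\<not> a divides b" using b(2) ac by (auto simp: cgenideal_def factor_def m_comm)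
  then obtain c where c: "c \<in> carrier V" "a = b \<otimes> c"
    using divides_linear[OF ac bc] by (auto simp: factor_def)
  have "c \<in> \<mm>"
  proof (rule ccontr)
    assume cm: "c \<notin> \<mm>"
    \<comment> \<open>No element of \<open>\<mm>\<close> divides \<open>c\<close>, so
      \<open>c\<close> divides them all. As \<open>PIdl c\<close> is not \<open>\<mm>\<close>
      either, maximality makes \<open>c\<close> a unit.\<close>
    have "\<mm> \<subseteq> PIdl c"
    proof
      fix x assume x: "x \<in> \<mm>"
      have "\<not> x divides c" using cm x m.I_r_closed by (auto simp: factor_def)
      then have "c divides x" using divides_linear c(1) x m.Icarr by blast
      then show "x \<in> PIdl c" using c(1) by (auto simp: cgenideal_def factor_def m_comm)
    qed
    then have "PIdl c = carrier V"
      using m.I_maximal[OF cgenideal_ideal[OF c(1)]] PIdl_ne[OF c(1)] c(1)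
      by (auto simp: cgenideal_def)
    then have "\<one> \<in> PIdl c" by simp
    then obtain e where e: "e \<in> carrier V" "\<one> = e \<otimes> c" by (auto simp: cgenideal_def)
    have "b = b \<otimes> (e \<otimes> c)" using bc by (simp flip: e(2))
    then have "b = a \<otimes> e" using e(1) c bc by (simp add: m_assoc m_comm[of c])
    then show False using nd e(1) by auto
  qed
  then show thesis using that b(1) c(2) by blast
qed

text \<open>Turns \<open>\<mm>\<close>-torsion into annihilation by \<open>\<mm>\<close> itself. The
  power with exponent 0 is the whole ring; each further step factors an element of
  \<open>\<mm>\<close> into two elements of \<open>\<mm>\<close>.\<close>

lemma nonprincipal_maximalideal_subset_pow:
  assumes m: "maximalideal \<mm> V" and np: "\<not> principalideal \<mm> V"
  shows "\<mm> \<subseteq> \<mm> [^]\<^bsub>ideals_set V\<^esub> (n::nat)"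
proof (induct n)
  case 0
  show ?case using maximalideal.axioms(1)[OF m] ideal.Icarr[of \<mm> V] by (auto simp: ideals_set_def)
next
  case (Suc n)
  show ?case
  proof
    fix a assume "a \<in> \<mm>"
    then obtain b c where "b \<in> \<mm>" "c \<in> \<mm>" "a = b \<otimes> c"
      using nonprincipal_maximalideal_prod[OF m np] by blast
    then show "a \<in> \<mm> [^]\<^bsub>ideals_set V\<^esub> Suc n"
      using Suc by (auto simp: ideals_set_def intro!: ideal_prod.prod)
  qed
qed

text \<open>Of the two factors of \<open>a\<close> in \<open>\<mm>\<close>, one divides the other,
  and the square of that one divides \<open>a\<close>.\<close>

lemma nonprincipal_maximalideal_square_divides:
  assumes m: "maximalideal \<mm> V" and np: "\<not> principalideal \<mm> V" and a: "a \<in> \<mm>"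
  shows "\<exists>b\<in>\<mm>. b \<otimes> b divides a"
proof -
  obtain b c where bc: "b \<in> \<mm>" "c \<in> \<mm>" "a = b \<otimes> c"
    using nonprincipal_maximalideal_prod[OF m np a] by blast
  then have car: "b \<in> carrier V" "c \<in> carrier V"
    using maximalideal.axioms(1)[OF m] ideal.Icarr[of \<mm> V] by auto
  have "b \<otimes> b divides a \<or> c \<otimes> c divides a"
    using divides_linear[OF car] bc(3) car divides_mult_rI divides_mult_lI by metis
  then show ?thesis using bc by blast
qed

text \<open>Iterated approximate square roots of \<open>t\<close> have arbitrarily small value
  compared with \<open>t\<close>, while every element of \<open>\<mm>\<close> has a power divisible
  by \<open>t\<close>. So the roots generate \<open>\<mm>\<close>.\<close>

lemma nonprincipal_maximalideal_generators:
  assumes fin: "krull_dim V < \<infinity>" and m: "maximalideal \<mm> V" and np: "\<not> principalideal \<mm> V"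
  obtains u :: "nat \<Rightarrow> 'a" where "\<And>n. u n \<in> \<mm>" "\<And>n. u n \<noteq> \<zero>" "\<And>n. u (Suc n) divides u n"
    "\<And>b. b \<in> \<mm> \<Longrightarrow> \<exists>n. u n divides b"
proof -
  interpret m: maximalideal \<mm> V by fact
  obtain t where t: "t \<in> \<mm>" "\<mm> \<subseteq> radical t" using maximalideal_subset_radical[OF fin m] by blast
  \<comment> \<open>In a domain the radical of zero is zero, and the zero ideal is
    principal.\<close>
  have "t \<noteq> \<zero>"
  proof
    assume "t = \<zero>"
    then have "b = \<zero>" if b: "b \<in> \<mm>" for b
      using t(2) b nat_pow_nonzero[of b] by (auto simp: radical_def factor_def)
    then have "\<mm> = {\<zero>}" using t(1) \<open>t = \<zero>\<close> by blast
    then show False using np zeropideal by simp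
  qed
  obtain f where f: "\<And>a. a \<in> \<mm> \<Longrightarrow> f a \<in> \<mm> \<and> f a \<otimes> f a divides a"
    using nonprincipal_maximalideal_square_divides[OF m np] by metis
  define u where "u n = (f ^^ n) t" for n
  have um: "u n \<in> \<mm>" for n by (induct n) (auto simp: u_def f t)
  then have uc: "u n \<in> carrier V" for n using m.Icarr by blast
  have sq: "u (Suc n) \<otimes> u (Suc n) divides u n" for n using f[OF um[of n]] by (simp add: u_def)
  have div: "u (Suc n) divides u n" for n
    using sq[of n] uc by (meson divides_prod_r divides_refl divides_trans m_closed)
  have pow: "u n [^] (2 ^ n :: nat) divides t" for n
  proof (induct n)
    case 0
    show ?case using uc[of 0] by (simp add: u_def)
  next
    case (Suc n)
    have "u (Suc n) [^] (2 ^ Suc n :: nat) = (u (Suc n) \<otimes> u (Suc n)) [^] (2 ^ n :: nat)"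
      using uc by (simp add: nat_pow_distrib nat_pow_mult mult_2)
    also have "\<dots> divides u n [^] (2 ^ n :: nat)" using divides_nat_pow sq uc by simp
    finally show ?case using Suc uc divides_trans by blast
  qed
  show thesis
  proof
    show "u n \<in> \<mm>" for n by (rule um)
    show "u (Suc n) divides u n" for n by (rule div)
    show "u n \<noteq> \<zero>" for n
    proof
      assume "u n = \<zero>"
      then have "\<zero> divides t" using pow[of n] by (simp add: nat_pow_zero)
      then show False using \<open>t \<noteq> \<zero>\<close> by (auto simp: factor_def)
    qed
    show "\<exists>n. u n divides b" if b: "b \<in> \<mm>" for b
    proof -
      obtain k :: nat where k: "t divides b [^] k" and bc: "b \<in> carrier V"
        using t(2) b by (auto simp: radical_def)
      \<comment> \<open>As k is at most \<open>2 ^ k\<close>, both sides can be brought to the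
        exponent \<open>2 ^ k\<close>, which is then cancelled.\<close>
      have "b [^] k divides b [^] (2 ^ k :: nat)"
        using nat_pow_divides_nat_pow[OF bc, of k "2 ^ k"] by (simp add: less_imp_le)
      then have "u k [^] (2 ^ k :: nat) divides b [^] (2 ^ k :: nat)"
        using pow[of k] k uc bc divides_trans by (meson nat_pow_closed m.Icarr t(1))
      then show ?thesis using nat_pow_divides_cancel uc bc by (meson pos2 zero_less_power)
    qed
  qed
qed

end


section \<open>Lifting along a countable chain of principal ideals\<close>

lemma module_homD:
  assumes "h \<in> module_hom R M N"
  shows "x \<in> carrier M \<Longrightarrow> h x \<in> carrier N"
    and "x \<in> carrier M \<Longrightarrow> y \<in> carrier M \<Longrightarrow> h (x \<oplus>\<^bsub>M\<^esub> y) = h x \<oplus>\<^bsub>N\<^esub> h y"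
    and "a \<in> carrier R \<Longrightarrow> x \<in> carrier M \<Longrightarrow> h (a \<odot>\<^bsub>M\<^esub> x) = a \<odot>\<^bsub>N\<^esub> h x"
  using assms by (auto simp: module_hom_def)

lemma module_hom_zero:
  assumes "h \<in> module_hom R M N" "module R M" "module R N"
  shows "h \<zero>\<^bsub>M\<^esub> = \<zero>\<^bsub>N\<^esub>"
proof -
  interpret M: module R M by fact
  interpret N: module R N by fact
  show ?thesis using module_homD(3)[OF assms(1), of "\<zero>\<^bsub>R\<^esub>" "\<zero>\<^bsub>M\<^esub>"] module_homD(1)[OF assms(1)] by simp
qed

lemma module_hom_neg:
  assumes "h \<in> module_hom R M N" "module R M" "module R N" "x \<in> carrier M"
  shows "h (\<ominus>\<^bsub>M\<^esub> x) = \<ominus>\<^bsub>N\<^esub> h x"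
proof -
  interpret M: module R M by fact
  interpret N: module R N by fact
  show ?thesis using module_homD(3)[OF assms(1), of "\<ominus>\<^bsub>R\<^esub> \<one>\<^bsub>R\<^esub>" x] module_homD(1)[OF assms(1)] assms(4)
    by (simp add: M.smult_l_minus N.smult_l_minus)
qed

lemma module_hom_diff:
  assumes "h \<in> module_hom R M N" "module R M" "module R N" "x \<in> carrier M" "y \<in> carrier M"
  shows "h (x \<ominus>\<^bsub>M\<^esub> y) = h x \<ominus>\<^bsub>N\<^esub> h y"
proof -
  interpret M: module R M by fact
  interpret N: module R N by fact
  show ?thesis using assms module_homD(2)[OF assms(1)] module_hom_neg[OF assms(1)]
    by (simp add: a_minus_def)
qed

section \<open>Maps from ideals into injective modules, and divisibility\<close>

text \<open>The map extends to the whole ring, where a linear map is determined by its value at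
  \<open>\<one>\<close>; this value is \<open>e\<close>.\<close>

lemma injective_module_ideal_hom:
  fixes R (structure)
  assumes "cring R" and inj: "injective_module R E" and J: "ideal J R"
    and \<phi>: "\<phi> \<in> module_hom R (ideal_module R J) E"
  shows "\<exists>e\<in>carrier E. \<forall>a\<in>J. \<phi> a = a \<odot>\<^bsub>E\<^esub> e"
proof -
  interpret cring R by fact
  interpret J: ideal J R by fact
  have "id \<in> module_hom R (ideal_module R J) (ideal_module R (carrier R))"
    using J.Icarr by (auto simp: module_hom_def ideal_module_def)
  from injective_module_extend[OF inj ideal_module_is_module[OF is_cring J]
      ideal_module_is_module[OF is_cring oneideal] this _ \<phi>]
  obtain h where h: "h \<in> module_hom R (ideal_module R (carrier R)) E" "\<And>a. a \<in> J \<Longrightarrow> h a = \<phi> a"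
    by (auto simp: ideal_module_def)
  have "h \<one> \<in> carrier E" using module_homD(1)[OF h(1)] by (simp add: ideal_module_def)
  moreover have "\<phi> a = a \<odot>\<^bsub>E\<^esub> h \<one>" if "a \<in> J" for a
    using module_homD(3)[OF h(1), of a "\<one>"] h(2)[OF that] J.Icarr[OF that] by (simp add: ideal_module_def)
  ultimately show ?thesis by blast
qed

text \<open>Multiplication by \<open>b\<close> is an injective endomorphism of the ring. Extending
  \<open>a \<mapsto> a \<odot> w\<close> along it and evaluating at \<open>\<one>\<close> gives the
  quotient of \<open>w\<close> by \<open>b\<close>.\<close>

lemma injective_module_divisible:
  fixes R (structure)
  assumes "domain R" and inj: "injective_module R E" and b: "b \<in> carrier R" "b \<noteq> \<zero>\<^bsub>R\<^esub>"
    and w: "w \<in> carrier E"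
  shows "\<exists>v\<in>carrier E. b \<odot>\<^bsub>E\<^esub> v = w"
proof -
  interpret domain R by fact
  interpret E: module R E using inj by (simp add: injective_module_def)
  let ?R = "ideal_module R (carrier R)"
  have R: "module R ?R" using ideal_module_is_module[OF is_cring oneideal] .
  have f: "(\<lambda>a. b \<otimes> a) \<in> module_hom R ?R ?R"
    using b by (auto simp: module_hom_def ideal_module_def r_distr m_lcomm)
  have i: "inj_on (\<lambda>a. b \<otimes> a) (carrier ?R)"
    using b by (auto simp: inj_on_def ideal_module_def m_lcancel)
  have g: "(\<lambda>a. a \<odot>\<^bsub>E\<^esub> w) \<in> module_hom R ?R E"
    using w by (auto simp: module_hom_def ideal_module_def E.smult_l_distr E.smult_assoc1)
  obtain h where h: "h \<in> module_hom R ?R E" "\<And>a. a \<in> carrier R \<Longrightarrow> h (b \<otimes> a) = a \<odot>\<^bsub>E\<^esub> w"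
    using injective_module_extend[OF inj R R f i g] by (auto simp: ideal_module_def)
  have "b \<odot>\<^bsub>E\<^esub> h \<one> = w"
    using module_homD(3)[OF h(1), of b "\<one>"] h(2)[of "\<one>"] b w by (simp add: ideal_module_def)
  moreover have "h \<one> \<in> carrier E" using module_homD(1)[OF h(1)] by (simp add: ideal_module_def)
  ultimately show ?thesis by blast
qed

section \<open>Compatible lifts and their gluing\<close>

text \<open>A Mittag-Leffler argument: the kernel of \<open>d1\<close> is an image of the injective
  \<open>E0\<close>, hence divisible, so multiplication by each \<open>c n\<close> is onto on it and
  the choices of preimages can be made compatible one after the other.\<close>

lemma compatible_preimages:
  assumes "domain R" and E0: "injective_module R E0" and E1: "module R E1" and E2: "module R E2"
    and d0: "d0 \<in> module_hom R E0 E1" and d1: "d1 \<in> module_hom R E1 E2"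
    and ex: "d0 ` carrier E0 = a_kernel E1 E2 d1"
    and c: "\<And>n::nat. c n \<in> carrier R" "\<And>n. c n \<noteq> \<zero>\<^bsub>R\<^esub>"
    and y: "\<And>n. y n \<in> d1 ` carrier E1" "\<And>n. y n = c n \<odot>\<^bsub>E2\<^esub> y (Suc n)"
  obtains z where "\<And>n. z n \<in> carrier E1" "\<And>n. d1 (z n) = y n" "\<And>n. z n = c n \<odot>\<^bsub>E1\<^esub> z (Suc n)"
proof -
  interpret domain R by fact
  interpret E0: module R E0 using E0 by (simp add: injective_module_def)
  interpret E1: module R E1 by fact
  interpret E2: module R E2 by fact
  have d10: "d1 (d0 x) = \<zero>\<^bsub>E2\<^esub>" if "x \<in> carrier E0" for x
    using ex that by (auto simp: a_kernel_def')
  have step: "\<exists>z'. (z' \<in> carrier E1 \<and> d1 z' = y (Suc n)) \<and> z = c n \<odot>\<^bsub>E1\<^esub> z'"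
    if z: "z \<in> carrier E1 \<and> d1 z = y n" for z n
  proof -
    obtain p where p: "p \<in> carrier E1" "d1 p = y (Suc n)" using y(1)[of "Suc n"] by auto
    have yc: "y n \<in> carrier E2" using module_homD(1)[OF d1] y(1)[of n] by auto
    have "d1 (c n \<odot>\<^bsub>E1\<^esub> p \<ominus>\<^bsub>E1\<^esub> z) = \<zero>\<^bsub>E2\<^esub>"
      using z p c y(2)[of n] yc module_hom_diff[OF d1 E1 E2] module_homD(3)[OF d1]
      by (simp add: a_minus_def E2.M.r_neg)
    \<comment> \<open>The failure of compatibility is some \<open>d0 w\<close>. Dividing
      \<open>w\<close> by \<open>c n\<close> yields \<open>v\<close>, and \<open>p\<close> is
      corrected by \<open>d0 v\<close> without changing its image under \<open>d1\<close>.\<close>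
    then have "c n \<odot>\<^bsub>E1\<^esub> p \<ominus>\<^bsub>E1\<^esub> z \<in> d0 ` carrier E0"
      using p z c by (auto simp: ex a_kernel_def')
    then obtain w where w: "w \<in> carrier E0" "d0 w = c n \<odot>\<^bsub>E1\<^esub> p \<ominus>\<^bsub>E1\<^esub> z" by auto
    obtain v where v: "v \<in> carrier E0" "c n \<odot>\<^bsub>E0\<^esub> v = w"
      using injective_module_divisible[OF \<open>domain R\<close> E0 c w(1)] by blast
    have dv: "d0 v \<in> carrier E1" using module_homD(1)[OF d0] v by blast
    have cv: "c n \<odot>\<^bsub>E1\<^esub> d0 v = c n \<odot>\<^bsub>E1\<^esub> p \<ominus>\<^bsub>E1\<^esub> z" using module_homD(3)[OF d0 c(1) v(1), of n] v w by simp
    have "c n \<odot>\<^bsub>E1\<^esub> (p \<ominus>\<^bsub>E1\<^esub> d0 v) = c n \<odot>\<^bsub>E1\<^esub> p \<ominus>\<^bsub>E1\<^esub> (c n \<odot>\<^bsub>E1\<^esub> p \<ominus>\<^bsub>E1\<^esub> z)"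
      unfolding cv[symmetric] using p dv c by (simp add: a_minus_def E1.smult_r_distr E1.smult_r_minus)
    also have "\<dots> = z" using p z c by (simp add: a_minus_def E1.M.minus_add E1.M.r_neg1 E1.M.r_neg2)
    finally have "z = c n \<odot>\<^bsub>E1\<^esub> (p \<ominus>\<^bsub>E1\<^esub> d0 v)" by simp
    moreover have "d1 (p \<ominus>\<^bsub>E1\<^esub> d0 v) = y (Suc n)"
      using p dv v module_hom_diff[OF d1 E1 E2] d10 module_homD(1)[OF d1 p(1)] by (simp add: a_minus_def)
    ultimately show ?thesis using p dv by blast
  qed
  have "\<exists>z. z \<in> carrier E1 \<and> d1 z = y 0" using y(1)[of 0] by auto
  then obtain z where "\<And>n. z n \<in> carrier E1 \<and> d1 (z n) = y n" "\<And>n. z n = c n \<odot>\<^bsub>E1\<^esub> z (Suc n)"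
    using dependent_nat_choice[of "\<lambda>n z. z \<in> carrier E1 \<and> d1 z = y n" "\<lambda>n z z'. z = c n \<odot>\<^bsub>E1\<^esub> z'"] step
    by metis
  then show thesis using that by blast
qed

text \<open>\<open>J\<close> is the increasing union of the free modules generated by the
  \<open>u n\<close>, so a compatible family \<open>z\<close> is a linear map on \<open>J\<close>
  with values \<open>z n\<close> at \<open>u n\<close>. Injectivity makes it multiplication by some
  \<open>e\<close>.\<close>

lemma chain_generated_ideal_hom:
  fixes R (structure)
  assumes "domain R" and E: "injective_module R E" and J: "ideal J R"
    and u: "\<And>n::nat. u n \<in> J" "\<And>n. u n \<noteq> \<zero>\<^bsub>R\<^esub>" "\<And>a. a \<in> J \<Longrightarrow> \<exists>n. u n divides\<^bsub>R\<^esub> a"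
    and c: "\<And>n. c n \<in> carrier R" "\<And>n. u n = c n \<otimes>\<^bsub>R\<^esub> u (Suc n)"
    and z: "\<And>n. z n \<in> carrier E" "\<And>n. z n = c n \<odot>\<^bsub>E\<^esub> z (Suc n)"
  shows "\<exists>e\<in>carrier E. \<forall>n. z n = u n \<odot>\<^bsub>E\<^esub> e"
proof -
  interpret domain R by fact
  interpret J: ideal J R by fact
  interpret E: module R E using E by (simp add: injective_module_def)
  have uc: "u n \<in> carrier R" for n using u(1) J.Icarr by blast
  have comp: "\<exists>r\<in>carrier R. u n = r \<otimes> u (n + k) \<and> z n = r \<odot>\<^bsub>E\<^esub> z (n + k)" for n k
  proof (induct k)
    case 0
    show ?case using uc z(1) by (intro bexI[of _ \<one>]) auto
  next
    case (Suc k)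
    then obtain r where r: "r \<in> carrier R" "u n = r \<otimes> u (n + k)" "z n = r \<odot>\<^bsub>E\<^esub> z (n + k)" by blast
    have "u n = (r \<otimes> c (n + k)) \<otimes> u (n + Suc k)" using r(1,2) c(1) c(2)[of "n + k"] uc by (simp add: m_assoc)
    moreover have "z n = (r \<otimes> c (n + k)) \<odot>\<^bsub>E\<^esub> z (n + Suc k)"
      using r(1,3) z(1) z(2)[of "n + k"] c(1) by (simp add: E.smult_assoc1)
    ultimately show ?case using r(1) c(1) by blast
  qed
  \<comment> \<open>The graph of the map sending \<open>r \<otimes> u n\<close> to
    \<open>r \<odot> z n\<close>, first as a relation, since \<open>r\<close> and \<open>n\<close>
    are not determined by the element.\<close>
  define G where "G a w \<longleftrightarrow> (\<exists>r\<in>carrier R. \<exists>n. a = r \<otimes> u n \<and> w = r \<odot>\<^bsub>E\<^esub> z n)" for a w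
  have G_later: "\<exists>r\<in>carrier R. a = r \<otimes> u (n + k) \<and> w = r \<odot>\<^bsub>E\<^esub> z (n + k)"
    if "r \<in> carrier R" "a = r \<otimes> u n" "w = r \<odot>\<^bsub>E\<^esub> z n" for a w r n k
  proof -
    obtain s where "s \<in> carrier R" "u n = s \<otimes> u (n + k)" "z n = s \<odot>\<^bsub>E\<^esub> z (n + k)" using comp by blast
    then show ?thesis using that uc z(1) by (intro bexI[of _ "r \<otimes> s"]) (auto simp: m_assoc E.smult_assoc1)
  qed
  have G2: "\<exists>r\<in>carrier R. \<exists>s\<in>carrier R. \<exists>n. a = r \<otimes> u n \<and> w = r \<odot>\<^bsub>E\<^esub> z n \<and> b = s \<otimes> u n \<and> v = s \<odot>\<^bsub>E\<^esub> z n"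
    if "G a w" "G b v" for a w b v
  proof -
    from that obtain r n s k where "r \<in> carrier R" "a = r \<otimes> u n" "w = r \<odot>\<^bsub>E\<^esub> z n"
      "s \<in> carrier R" "b = s \<otimes> u k" "v = s \<odot>\<^bsub>E\<^esub> z k" unfolding G_def by blast
    \<comment> \<open>The index \<open>n + k\<close> serves both representations. With a common
      index, \<open>u n\<close> can be cancelled, which gives uniqueness below.\<close>
    then show ?thesis using G_later[of r a n w k] G_later[of s b k v n] by (metis add.commute)
  qed
  have G_uniq: "w = v" if G: "G a w" "G a v" for a w v
  proof -
    obtain r s n where "r \<in> carrier R" "s \<in> carrier R" "r \<otimes> u n = s \<otimes> u n"
      "w = r \<odot>\<^bsub>E\<^esub> z n" "v = s \<odot>\<^bsub>E\<^esub> z n" using G2[OF G] by metis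
    then show ?thesis using m_rcancel[OF u(2) uc] by metis
  qed
  define \<phi> where "\<phi> a = (THE w. G a w)" for a
  have \<phi>: "\<phi> a = w" if "G a w" for a w unfolding \<phi>_def using that G_uniq by blast
  have G_car: "w \<in> carrier E" if "G a w" for a w using that z(1) by (auto simp: G_def)
  have G_total: "G a (\<phi> a)" if a: "a \<in> J" for a
  proof -
    obtain n r where "r \<in> carrier R" "a = u n \<otimes> r" using u(3)[OF a] by (auto simp: factor_def)
    then have "G a (r \<odot>\<^bsub>E\<^esub> z n)" using uc m_comm unfolding G_def by blast
    then show ?thesis using \<phi> by simp
  qed
  have "\<phi> \<in> module_hom R (ideal_module R J) E"
    unfolding module_hom_def ideal_module_def
  proof (simp, intro conjI ballI funcsetI)
    show "\<phi> a \<in> carrier E" if "a \<in> J" for a using G_car[OF G_total[OF that]] .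
    show "\<phi> (a \<oplus> b) = \<phi> a \<oplus>\<^bsub>E\<^esub> \<phi> b" if ab: "a \<in> J" "b \<in> J" for a b
    proof (rule \<phi>)
      obtain r s n where "r \<in> carrier R" "s \<in> carrier R" "a = r \<otimes> u n" "b = s \<otimes> u n"
        "\<phi> a = r \<odot>\<^bsub>E\<^esub> z n" "\<phi> b = s \<odot>\<^bsub>E\<^esub> z n" using G2[OF G_total[OF ab(1)] G_total[OF ab(2)]] by metis
      then show "G (a \<oplus> b) (\<phi> a \<oplus>\<^bsub>E\<^esub> \<phi> b)" unfolding G_def using uc z(1)
        by (intro bexI[of _ "r \<oplus> s"] exI[of _ n]) (auto simp: l_distr E.smult_l_distr)
    qed
    show "\<phi> (s \<otimes> a) = s \<odot>\<^bsub>E\<^esub> \<phi> a" if sa: "s \<in> carrier R" "a \<in> J" for s a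
    proof (rule \<phi>)
      obtain r n where "r \<in> carrier R" "a = r \<otimes> u n" "\<phi> a = r \<odot>\<^bsub>E\<^esub> z n"
        using G_total[OF sa(2)] unfolding G_def by metis
      then show "G (s \<otimes> a) (s \<odot>\<^bsub>E\<^esub> \<phi> a)" unfolding G_def using uc z(1) sa(1)
        by (intro bexI[of _ "s \<otimes> r"] exI[of _ n]) (auto simp: m_assoc E.smult_assoc1)
    qed
  qed
  then obtain e where e: "e \<in> carrier E" "\<And>a. a \<in> J \<Longrightarrow> \<phi> a = a \<odot>\<^bsub>E\<^esub> e"
    using injective_module_ideal_hom[OF is_cring E J] by blast
  have "G (u n) (z n)" for n unfolding G_def using uc z(1) by (intro bexI[of _ \<one>] exI[of _ n]) auto
  then have "z n = u n \<odot>\<^bsub>E\<^esub> e" for n using e(2)[OF u(1)] \<phi> by metis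
  then show ?thesis using e(1) by blast
qed

text \<open>The degree bound 3 arises here: \<open>x\<close> is lifted to degree
  \<open>k + 2\<close>, the multiples of that lift to degree \<open>k + 1\<close>, and the latter
  lifts are corrected by boundaries from degree \<open>k\<close>, where divisibility is
  used.\<close>

lemma annihilated_cocycle_lift:
  fixes R (structure)
  assumes dom: "domain R" and E: "\<And>n::nat. injective_module R (E n)"
    and d: "\<And>n. d n \<in> module_hom R (E n) (E (Suc n))"
    and ex: "\<And>n. d n ` carrier (E n) = a_kernel (E (Suc n)) (E (Suc (Suc n))) (d (Suc n))"
    and J: "ideal J R"
    and u: "\<And>n::nat. u n \<in> J" "\<And>n. u n \<noteq> \<zero>\<^bsub>R\<^esub>" "\<And>n. u (Suc n) divides\<^bsub>R\<^esub> u n"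
      "\<And>a. a \<in> J \<Longrightarrow> \<exists>n. u n divides\<^bsub>R\<^esub> a"
    and x: "x \<in> carrier (E (k + 3))" "d (k + 3) x = \<zero>\<^bsub>E (k + 4)\<^esub>"
    and xJ: "\<And>a. a \<in> J \<Longrightarrow> a \<odot>\<^bsub>E (k + 3)\<^esub> x = \<zero>\<^bsub>E (k + 3)\<^esub>"
  shows "\<exists>y\<in>carrier (E (k + 2)). d (k + 2) y = x \<and> (\<forall>a\<in>J. a \<odot>\<^bsub>E (k + 2)\<^esub> y = \<zero>\<^bsub>E (k + 2)\<^esub>)"
proof -
  interpret domain R by fact
  interpret J: ideal J R by fact
  let ?E1 = "E (Suc k)" and ?E2 = "E (Suc (Suc k))" and ?E3 = "E (Suc (Suc (Suc k)))"
  have md: "module R (E n)" for n using E by (simp add: injective_module_def)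
  interpret E1: module R ?E1 by (rule md)
  interpret E2: module R ?E2 by (rule md)
  interpret E3: module R ?E3 by (rule md)
  have uc: "u n \<in> carrier R" for n using u(1) J.Icarr by blast
  have "x \<in> d (Suc (Suc k)) ` carrier ?E2"
    using x by (simp add: ex a_kernel_def' eval_nat_numeral)
  then obtain y where y: "y \<in> carrier ?E2" "d (Suc (Suc k)) y = x" by auto
  have "\<forall>n. \<exists>c\<in>carrier R. u n = c \<otimes> u (Suc n)"
    using u(3) uc m_comm by (metis factor_def)
  then obtain c where c: "\<And>n. c n \<in> carrier R" "\<And>n. u n = c n \<otimes> u (Suc n)" by metis
  have c0: "c n \<noteq> \<zero>" for n using c(2)[of n] u(2)[of n] uc by auto
  \<comment> \<open>The differential sends this element to \<open>u n \<odot> x\<close>, which is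
    zero, so exactness applies.\<close>
  have uy: "u n \<odot>\<^bsub>?E2\<^esub> y \<in> d (Suc k) ` carrier ?E1" for n
    using y uc xJ[OF u(1)] module_homD(3)[OF d] by (simp add: ex a_kernel_def' eval_nat_numeral)
  have uyc: "u n \<odot>\<^bsub>?E2\<^esub> y = c n \<odot>\<^bsub>?E2\<^esub> (u (Suc n) \<odot>\<^bsub>?E2\<^esub> y)" for n
    using c uc y by (metis E2.smult_assoc1)
  obtain z where z: "\<And>n. z n \<in> carrier ?E1" "\<And>n. d (Suc k) (z n) = u n \<odot>\<^bsub>?E2\<^esub> y"
      "\<And>n. z n = c n \<odot>\<^bsub>?E1\<^esub> z (Suc n)"
    using compatible_preimages[where y = "\<lambda>n. u n \<odot>\<^bsub>?E2\<^esub> y",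
        OF dom E md md d d ex c(1) c0 uy uyc] by blast
  obtain e where e: "e \<in> carrier ?E1" "\<And>n. z n = u n \<odot>\<^bsub>?E1\<^esub> e"
    using chain_generated_ideal_hom[where z = z, OF dom E J u(1,2,4) c z(1,3)] by blast
  have de: "d (Suc k) e \<in> carrier ?E2" using module_homD(1)[OF d] e(1) by blast
  let ?y = "y \<ominus>\<^bsub>?E2\<^esub> d (Suc k) e"
  have yc: "?y \<in> carrier ?E2" using y de by simp
  have "d (Suc (Suc k)) (d (Suc k) e) = \<zero>\<^bsub>?E3\<^esub>"
    using ex[of "Suc k"] e(1) by (auto simp: a_kernel_def')
  then have "d (Suc (Suc k)) ?y = x"
    using module_hom_diff[OF d md md y(1) de] y x by (simp add: a_minus_def eval_nat_numeral)
  moreover have "a \<odot>\<^bsub>?E2\<^esub> ?y = \<zero>\<^bsub>?E2\<^esub>" if a: "a \<in> J" for a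
  proof -
    obtain n r where r: "r \<in> carrier R" "a = u n \<otimes> r" using u(4)[OF a] by (auto simp: factor_def)
    \<comment> \<open>Both sides equal \<open>d (Suc k) (z n)\<close>. So each \<open>u n\<close>,
      and with it every multiple of some \<open>u n\<close>, annihilates \<open>?y\<close>.\<close>
    have "u n \<odot>\<^bsub>?E2\<^esub> d (Suc k) e = u n \<odot>\<^bsub>?E2\<^esub> y"
      using module_homD(3)[OF d uc e(1)] z(2) e(2) by metis
    then have "u n \<odot>\<^bsub>?E2\<^esub> ?y = \<zero>\<^bsub>?E2\<^esub>"
      using y de uc by (simp add: a_minus_def E2.smult_r_distr E2.smult_r_minus E2.M.r_neg)
    then show ?thesis using r yc uc m_comm[OF uc r(1)] by (simp add: E2.smult_assoc1)
  qed
  ultimately show ?thesis using yc by (auto simp: eval_nat_numeral intro!: bexI[of _ ?y])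
qed

section \<open>Torsion and the vanishing of cohomology\<close>

text \<open>What a power of \<open>I\<close> annihilates is annihilated by its subset
  \<open>I\<close>; conversely the exponent 1 serves as witness.\<close>

lemma torsion_carrier:
  assumes "module R M" and "ideal I R" and idem: "\<And>n::nat. I \<subseteq> I [^]\<^bsub>ideals_set R\<^esub> n"
  shows "carrier (torsion_module R I M) = {x \<in> carrier M. \<forall>a\<in>I. a \<odot>\<^bsub>M\<^esub> x = \<zero>\<^bsub>M\<^esub>}"
proof -
  interpret module R M by fact
  interpret cring R by (rule R.is_cring)
  interpret ISet: comm_monoid "ideals_set R" by (rule ideals_set_is_comm_monoid)
  have "I [^]\<^bsub>ideals_set R\<^esub> (1::nat) = I" 
    using ISet.l_one[of I] assms(2) by (simp add: ideals_set_def)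
  then show ?thesis using idem unfolding torsion_module_def by (auto intro!: exI[of _ "1::nat"])
qed

lemma zero_cohomology:
  assumes "\<zero>\<^bsub>C i\<^esub> \<in> cocycles C d i"
    and "\<And>x y. x \<in> cocycles C d i \<Longrightarrow> y \<in> cocycles C d i \<Longrightarrow> x \<oplus>\<^bsub>C i\<^esub> y \<in> cocycles C d i"
    and "\<And>x y. x \<in> cocycles C d i \<Longrightarrow> y \<in> cocycles C d i \<Longrightarrow>
      \<exists>h\<in>cocycles C d i. h \<oplus>\<^bsub>C i\<^esub> x = y"
    and "coboundaries C d i = cocycles C d i"
  shows "zero_module (cohomology C d i)"
proof -
  let ?N = "cocycles C d i"
  \<comment> \<open>Translation by \<open>x\<close> maps the cocycles onto themselves, so the only
    coset is the subgroup itself, which is the zero of the quotient.\<close>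
  have "(\<Union>h\<in>?N. {h \<oplus>\<^bsub>C i\<^esub> x}) = ?N" if "x \<in> ?N" for x
    using assms(2,3) that by fastforce
  then show ?thesis using assms(1,4)
    by (auto simp: zero_module_def cohomology_def quotient_module_def A_RCOSETS_def' a_r_coset_def')
qed

theorem corollary4p2p6:
  fixes V :: "('a, 'r) ring_scheme"
    and \<mm> :: "'a set"
    and M :: "('a, 'b, 'm) module_scheme"
    and E :: "nat \<Rightarrow> ('a, 'e, 'n) module_scheme"
    and d :: "nat \<Rightarrow> 'e \<Rightarrow> 'e"
    and \<epsilon> :: "'b \<Rightarrow> 'e"
    and i :: nat
  assumes "valuation_ring V"
    and "krull_dim V < \<infinity>"
    and "maximalideal \<mm> V"
    and "\<not> principalideal \<mm> V"
    and "module V M"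
    and "injective_resolution V M E d \<epsilon>"
    and "i \<ge> 3"
  shows "zero_module (torsion_cohomology V \<mm> E d i)"
proof -
  interpret valuation_ring V by fact
  interpret m: maximalideal \<mm> V by fact
  obtain k where i: "i = k + 3" using \<open>i \<ge> 3\<close> by (metis add.commute le_Suc_ex)
  have E: "injective_module V (E n)" and d: "d n \<in> module_hom V (E n) (E (Suc n))"
    and ex: "d n ` carrier (E n) = a_kernel (E (Suc n)) (E (Suc (Suc n))) (d (Suc n))" for n
    using assms(6) by (auto simp: injective_resolution_def)
  have md: "module V (E n)" for n using E by (simp add: injective_module_def)
  interpret Ei: module V "E i" by (rule md)
  interpret Ej: module V "E (Suc i)" by (rule md)
  define C where "C n = torsion_module V \<mm> (E n)" for n
  have C: "carrier (C n) = {x \<in> carrier (E n). \<forall>a\<in>\<mm>. a \<odot>\<^bsub>E n\<^esub> x = \<zero>\<^bsub>E n\<^esub>}" for n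
    unfolding C_def
    using torsion_carrier[OF md m.is_ideal nonprincipal_maximalideal_subset_pow[OF assms(3,4)]] .
  have C0: "\<zero>\<^bsub>C n\<^esub> = \<zero>\<^bsub>E n\<^esub>" and Cadd: "x \<oplus>\<^bsub>C n\<^esub> y = x \<oplus>\<^bsub>E n\<^esub> y" for n x y
    by (simp_all add: C_def torsion_module_def)
  have Z: "cocycles C d i = {x \<in> carrier (E i). (\<forall>a\<in>\<mm>. a \<odot>\<^bsub>E i\<^esub> x = \<zero>\<^bsub>E i\<^esub>) \<and> d i x = \<zero>\<^bsub>E (Suc i)\<^esub>}"
    by (auto simp: cocycles_def a_kernel_def' C C0)
  \<comment> \<open>As \<open>i\<close> is positive, the coboundaries are the images of the torsion
    elements one degree below, not of all of \<open>E (k + 2)\<close>.\<close>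
  have Bi: "coboundaries C d i = d (k + 2) ` carrier (C (k + 2))"
    by (simp add: coboundaries_def i eval_nat_numeral)
  obtain u :: "nat \<Rightarrow> 'a" where u: "\<And>n. u n \<in> \<mm>" "\<And>n. u n \<noteq> \<zero>\<^bsub>V\<^esub>" "\<And>n. u (Suc n) divides\<^bsub>V\<^esub> u n"
    "\<And>b. b \<in> \<mm> \<Longrightarrow> \<exists>n. u n divides\<^bsub>V\<^esub> b"
    using nonprincipal_maximalideal_generators[OF assms(2-4)] by blast
  \<comment> \<open>The essential inclusion: a preimage must be found that is itself annihilated by
    \<open>\<mm>\<close>.\<close>
  have "cocycles C d i \<subseteq> coboundaries C d i"
  proof
    fix x assume "x \<in> cocycles C d i"
    then have x: "x \<in> carrier (E (k + 3))" "d (k + 3) x = \<zero>\<^bsub>E (k + 4)\<^esub>"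
      "\<And>a. a \<in> \<mm> \<Longrightarrow> a \<odot>\<^bsub>E (k + 3)\<^esub> x = \<zero>\<^bsub>E (k + 3)\<^esub>"
      unfolding Z by (auto simp: i eval_nat_numeral)
    show "x \<in> coboundaries C d i"
      using annihilated_cocycle_lift[where E = E and d = d and u = u,
          OF domain_axioms E d ex m.is_ideal u x]
      unfolding Bi C by (auto intro!: image_eqI)
  qed
  moreover have "coboundaries C d i \<subseteq> cocycles C d i"
  proof
    fix x assume "x \<in> coboundaries C d i"
    then obtain y where y: "y \<in> carrier (E (k + 2))" "x = d (k + 2) y"
      "\<And>a. a \<in> \<mm> \<Longrightarrow> a \<odot>\<^bsub>E (k + 2)\<^esub> y = \<zero>\<^bsub>E (k + 2)\<^esub>" unfolding Bi C by blast
    have ik: "i = Suc (k + 2)" by (simp add: i)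
    have "a \<odot>\<^bsub>E i\<^esub> x = \<zero>\<^bsub>E i\<^esub>" if "a \<in> \<mm>" for a
      using module_homD(3)[OF d m.Icarr[OF that] y(1)] y(2,3) that
        module_hom_zero[OF d[of "k + 2"] md md] unfolding ik by simp
    moreover have "x \<in> carrier (E i) \<and> d i x = \<zero>\<^bsub>E (Suc i)\<^esub>"
      using ex[of "k + 2"] y(1,2) unfolding ik by (auto simp: a_kernel_def')
    ultimately show "x \<in> cocycles C d i" unfolding Z by blast
  qed
  ultimately have BZ: "coboundaries C d i = cocycles C d i" by blast
  have add: "x \<oplus>\<^bsub>E i\<^esub> y \<in> cocycles C d i" if "x \<in> cocycles C d i" "y \<in> cocycles C d i" for x y
    using that m.Icarr module_homD(2)[OF d]
    by (auto simp: Z Ei.smult_r_distr)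
  have neg: "\<ominus>\<^bsub>E i\<^esub> x \<in> cocycles C d i" if "x \<in> cocycles C d i" for x
    using that m.Icarr module_hom_neg[OF d md md]
    by (auto simp: Z Ei.smult_r_minus)
  have Zc: "x \<in> carrier (E i)" if "x \<in> cocycles C d i" for x using that by (simp add: Z)
  have "zero_module (cohomology C d i)"
  proof (rule zero_cohomology, unfold C0 Cadd)
    show "\<zero>\<^bsub>E i\<^esub> \<in> cocycles C d i"
      using m.Icarr module_hom_zero[OF d md md] by (auto simp: Z)
    show "\<exists>h\<in>cocycles C d i. h \<oplus>\<^bsub>E i\<^esub> x = y" if xy: "x \<in> cocycles C d i" "y \<in> cocycles C d i" for x y
      using add[OF xy(2) neg[OF xy(1)]] Zc[OF xy(1)] Zc[OF xy(2)]
      by (intro bexI[of _ "y \<oplus>\<^bsub>E i\<^esub> \<ominus>\<^bsub>E i\<^esub> x"]) (auto simp: Ei.M.a_assoc Ei.M.l_neg)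
    show "coboundaries C d i = cocycles C d i" by (rule BZ)
  qed (rule add)
  then show ?thesis by (simp add: torsion_cohomology_def C_def[abs_def])
qed

end
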